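(* If $G$ is a bounded convex domain in $\mathbb{C}$, then the isometric Bohr abscissa $\mathbf{b}(G)$ does not depend on the choice of $G$; that is, for any two bounded convex domains $G_1,G_2\subset\mathbb{C}$ one has $\mathbf{b}(G_1)=\mathbf{b}(G_2)$.
   Context: A domain is a nonempty connected open set. $\Pi=\{s\in\mathbb{C}:\Re s>0\}$ is the right half-plane and $H^\infty(\Pi)$ is the space of bounded holomorphic functions on $\Pi$. For a domain $G\subset\mathbb{C}$, $\widetilde G$ denotes its convex hull (so $\widetilde G=G$ if $G$ is convex). Isometric Bohr abscissa: for a domain $G\subset\mathbb{C}$ with $\widetilde G\ne\mathbb{C}$, $\mathbf{b}(G)$ is the infimum of those real $\sigma\ge 0$ such that for every $f\in H^\infty(\Pi)$ with $f(\Pi)\subset G$ that is represented in $\Pi$ by a convergent ordinary Dirichlet series $f(s)=\sum_{n=1}^\infty a_n n^{-s}$ one has $$\sum_{n=2}^\infty \frac{|a_n|}{n^\sigma}<\operatorname{dist}(a_1,\partial\widetilde G).$$ *)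

theory Defs
  imports "HOL-Analysis.Analysis"
begin

definition planar_domain :: "complex set \<Rightarrow> bool" where
  "planar_domain G \<longleftrightarrow> open G \<and> connected G \<and> G \<noteq> {}"

definition right_half_plane :: "complex set" where
  "right_half_plane = {s. Re s > 0}"

definition Hinfty :: "complex set \<Rightarrow> (complex \<Rightarrow> complex) set" where
  "Hinfty U = {f. f holomorphic_on U \<and> bounded (f ` U)}"

text \<open>
  Coefficient sequences are indexed as in the mathematics, starting from \<open>a 1\<close>; the value
  \<open>a 0\<close> is never used. Convergence is that of the partial sums, not absolute convergence.
\<close>

definition dirichlet_represents :: "(nat \<Rightarrow> complex) \<Rightarrow> (complex \<Rightarrow> complex) \<Rightarrow> complex set \<Rightarrow> bool" where
  "dirichlet_represents a f U \<longleftrightarrow>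
     (\<forall>s\<in>U. (\<lambda>n. a (Suc n) * of_nat (Suc n) powr (- s)) sums f s)"

text \<open>
  The majorant series starts at the index 2. It has nonnegative terms, and if it diverges its sum
  is infinite, so that the strict inequality fails; hence the summability requirement.
\<close>

definition bohr_inequality :: "complex set \<Rightarrow> (nat \<Rightarrow> complex) \<Rightarrow> real \<Rightarrow> bool" where
  "bohr_inequality G a \<sigma> \<longleftrightarrow>
     summable (\<lambda>n. norm (a (n + 2)) / real (n + 2) powr \<sigma>) \<and>
     (\<Sum>n. norm (a (n + 2)) / real (n + 2) powr \<sigma>) < infdist (a 1) (frontier (convex hull G))"

text \<open>
  The infimum is taken in the extended reals, so that it is \<open>\<infinity>\<close> when there is no
  admissible \<open>\<sigma>\<close>. The notion is meant for domains whose convex hull is not the whole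
  plane; the frontier of the hull is then nonempty and \<^const>\<open>infdist\<close> is the genuine
  distance. Every bounded domain is of this kind.
\<close>

definition isometric_bohr_abscissa :: "complex set \<Rightarrow> ereal" where
  "isometric_bohr_abscissa G =
     (INF \<sigma>\<in>{\<sigma>::real. 0 \<le> \<sigma> \<and>
        (\<forall>f a. f \<in> Hinfty right_half_plane \<longrightarrow> f ` right_half_plane \<subseteq> G \<longrightarrow>
               dirichlet_represents a f right_half_plane \<longrightarrow> bohr_inequality G a \<sigma>)}.
        ereal \<sigma>)"

end

theory Submission
  imports Defs
begin

text \<open>
  Seen from very close to a boundary point that an inscribed disc touches, a convex domain
  looks like a half-plane, and from any boundary point it lies inside one. Both
  comparisons are affine, and an affine map \<open>z \<mapsto> c + k * z\<close> acts on Dirichlet series by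
  multiplying all coefficients of index at least 2 by \<open>k\<close>. So all these domains
  have the abscissa of the half-plane; the proof goes directly from one domain to the other.

  Let \<open>\<sigma>\<close> be admissible for \<open>G2\<close>, let \<open>f\<close> map into \<open>G1\<close>, let \<open>q\<close> be a point of the boundary of
  \<open>G1\<close> nearest to \<open>a 1\<close> and \<open>d\<close> its distance from \<open>a 1\<close>. Move a supporting line of \<open>G1\<close> at \<open>q\<close> to the
  imaginary axis and shift by a small \<open>\<epsilon>\<close>: the function obtained is bounded, has real part at least
  \<open>\<epsilon>\<close>, and its first coefficient has real part at most \<open>d + \<epsilon>\<close>. Shrunk by a small factor \<open>\<delta>\<close>,
  it takes its values in a disc tangent to the imaginary axis at the origin, which is placed
  inside \<open>G2\<close> so that it touches the boundary
  (\<open>convex_inscribed_tangent_ball\<close>, \<open>small_dilation_in_tangent_disc\<close>). The Bohr inequality in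
  \<open>G2\<close> bounds \<open>\<delta>\<close> times the majorant sum of \<open>f\<close> by \<open>\<delta> * (d + 2 * \<epsilon>)\<close>. Dividing by \<open>\<delta>\<close> and
  letting \<open>\<epsilon>\<close> tend to 0 gives the Bohr inequality for \<open>f\<close> in \<open>G1\<close>, at the same \<open>\<sigma>\<close> but with a
  non-strict sign (\<open>bohr_sum_le_of_admissible\<close>).

  Every \<open>\<tau> > \<sigma>\<close> restores strictness (\<open>bohr_admissible_transfer\<close>), because the exponent \<open>\<tau>\<close>
  shrinks a sum over \<open>n \<ge> 2\<close> at least by the factor \<open>2 powr (\<sigma> - \<tau>)\<close>. An infimum does not notice
  the difference between \<open>\<sigma>\<close> and the numbers above it, and the two domains can be exchanged.
\<close>

section \<open>First coefficient and affine images of Dirichlet series\<close>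

text \<open>
  Convergence at \<open>s = 1\<close> forces \<open>a n / n\<close> to be bounded. At \<open>s = k + 3\<close> the terms of index at
  least 2 are therefore dominated by \<open>(1/2) ^ k\<close> times the terms of a convergent series.
\<close>
lemma dirichlet_first_coefficient_tendsto:
  assumes "dirichlet_represents a f right_half_plane"
  shows "(\<lambda>k. f (of_nat (k + 3))) \<longlonglongrightarrow> a 1"
proof -
  have sums_at: "(\<lambda>n. a (Suc n) * of_nat (Suc n) powr (- of_nat m)) sums f (of_nat m)"
    if "m > 0" for m :: nat
    using assms that by (auto simp: dirichlet_represents_def right_half_plane_def)
  have pw: "of_nat (Suc n) powr (- of_nat m) = (1 / of_nat (Suc n) ^ m :: complex)" for n m
    by (simp add: powr_minus powr_nat inverse_eq_divide del: of_nat_Suc)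
  have "(\<lambda>n. a (Suc n) * of_nat (Suc n) powr (- of_nat 1)) \<longlonglongrightarrow> 0"
    by (rule summable_LIMSEQ_zero[OF sums_summable[OF sums_at]]) simp
  then have "Bseq (\<lambda>n. a (Suc n) / of_nat (Suc n))"
    unfolding pw using convergent_imp_Bseq[OF convergentI] by simp
  then obtain M where M: "\<And>n. norm (a (Suc n) / of_nat (Suc n)) \<le> M" and M0: "M > 0"
    using BseqE by blast
  \<comment> \<open>the tail at \<open>s = k + 3\<close>: one power is spent on the bound \<open>M\<close>, two on summability\<close>
  define t where "t = (\<lambda>k n. a (Suc (Suc n)) / of_nat (Suc (Suc n)) ^ (k + 3))"
  define h :: "nat \<Rightarrow> real" where "h = (\<lambda>n. M * inverse (real (Suc n) ^ 2))"
  have h: "summable h"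
    unfolding h_def using inverse_power_summable[of 2, where ?'a = real]
    by (intro summable_mult) (subst summable_Suc_iff, simp)
  have bound: "norm (t k n) \<le> (1/2) ^ k * h n" for k n
  proof -
    let ?x = "real (Suc (Suc n))"
    have "norm (t k n) = norm (a (Suc (Suc n)) / of_nat (Suc (Suc n))) * ((1 / ?x) ^ k * (1 / ?x ^ 2))"
      unfolding t_def by (simp add: norm_divide norm_mult norm_power power_add eval_nat_numeral field_simps del: of_nat_Suc)
    also have "\<dots> \<le> M * ((1 / 2) ^ k * (1 / real (Suc n) ^ 2))"
      using M0 by (intro mult_mono M power_mono divide_left_mono) (auto simp: field_simps)
    finally show ?thesis by (simp add: h_def inverse_eq_divide mult_ac)
  qed
  have f_eq: "f (of_nat (k + 3)) = a 1 + suminf (t k)" and nt: "summable (\<lambda>n. norm (t k n))" for k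
  proof -
    show *: "summable (\<lambda>n. norm (t k n))"
      by (rule summable_comparison_test'[OF summable_mult[OF h, of "(1/2)^k"]])
         (use bound in auto)
    define F where "F = (\<lambda>n. a (Suc n) / of_nat (Suc n) ^ (k + 3))"
    have "F sums f (of_nat (k + 3))"
      using sums_at[of "k + 3"] unfolding pw F_def by simp
    moreover have "F 0 = a 1" and "t k = (\<lambda>n. F (Suc n))"
      by (simp_all add: F_def t_def)
    ultimately have "t k sums (f (of_nat (k + 3)) - a 1)"
      by (simp add: sums_Suc_iff del: One_nat_def)
    then show "f (of_nat (k + 3)) = a 1 + suminf (t k)"
      by (simp add: sums_unique[symmetric])
  qed
  have "norm (f (of_nat (k + 3)) - a 1) \<le> (1/2) ^ k * suminf h" for k
  proof -
    have "norm (suminf (t k)) \<le> (\<Sum>n. norm (t k n))"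
      by (rule summable_norm[OF nt])
    also have "\<dots> \<le> (\<Sum>n. (1/2) ^ k * h n)"
      by (intro suminf_le nt summable_mult h bound)
    finally show ?thesis unfolding f_eq by (simp add: suminf_mult[OF h])
  qed
  moreover have "(\<lambda>k. (1/2) ^ k * suminf h) \<longlonglongrightarrow> 0"
    by (rule tendsto_mult_left_zero, rule LIMSEQ_power_zero) simp
  ultimately have "(\<lambda>k. f (of_nat (k + 3)) - a 1) \<longlonglongrightarrow> 0"
    by (rule Lim_null_comparison[OF always_eventually[OF allI]])
  then show ?thesis by (simp add: LIM_zero_iff)
qed

lemma dirichlet_first_coefficient_in_closure:
  assumes "dirichlet_represents a f right_half_plane" and "f ` right_half_plane \<subseteq> G"
  shows "a 1 \<in> closure G"
proof -
  have "of_nat (k + 3) \<in> right_half_plane" for k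
    by (simp add: right_half_plane_def)
  then have "f (of_nat (k + 3)) \<in> G" for k
    using assms(2) by blast
  then show ?thesis
    using dirichlet_first_coefficient_tendsto[OF assms(1)] unfolding closure_sequential
    by (intro exI[of _ "\<lambda>k. f (of_nat (k + 3))"]) simp
qed

lemma dirichlet_represents_affine:
  assumes "dirichlet_represents a f U"
  shows "dirichlet_represents (\<lambda>n. (if n = 1 then c else 0) + k * a n) (\<lambda>s. c + k * f s) U"
  unfolding dirichlet_represents_def
proof
  fix s assume "s \<in> U"
  then have "(\<lambda>n. k * (a (Suc n) * of_nat (Suc n) powr (- s))) sums (k * f s)"
    using assms sums_mult unfolding dirichlet_represents_def by blast
  moreover have "(\<lambda>n. if n = 0 then c else 0) sums c"
    by (rule sums_single)
  ultimately have "(\<lambda>n. (if n = 0 then c else 0) + k * (a (Suc n) * of_nat (Suc n) powr (- s)))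
      sums (c + k * f s)"
    by (rule sums_add[rotated])
  moreover have "(if n = 0 then c else 0) + k * (a (Suc n) * of_nat (Suc n) powr (- s)) =
      ((if Suc n = 1 then c else 0) + k * a (Suc n)) * of_nat (Suc n) powr (- s)" for n
    by (cases n) (auto simp: algebra_simps)
  ultimately show "(\<lambda>n. ((if Suc n = 1 then c else 0) + k * a (Suc n)) * of_nat (Suc n) powr (- s))
      sums (c + k * f s)"
    by simp
qed

section \<open>Supporting lines and inscribed tangent discs\<close>

lemma convex_supporting_unit_normal:
  fixes S :: "'a::euclidean_space set"
  assumes "convex S" and "S \<noteq> {}" and "q \<notin> S"
  obtains v where "norm v = 1" and "\<And>z. z \<in> S \<Longrightarrow> inner v (z - q) \<ge> 0"
proof -
  obtain a b where a: "a \<noteq> 0" "inner a q \<le> b" "\<And>z. z \<in> S \<Longrightarrow> inner a z \<ge> b"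
    using separating_hyperplane_sets[of "{q}" S] assms by auto
  show ?thesis
  proof (rule that)
    show "norm (a /\<^sub>R norm a) = 1" using a by simp
    show "inner (a /\<^sub>R norm a) (z - q) \<ge> 0" if "z \<in> S" for z
      using a(2) a(3)[OF that] by (simp add: inner_diff_right mult_left_mono)
  qed
qed

text \<open>
  The largest ball in \<open>S\<close> around a given centre touches the frontier at some point \<open>p\<close>. A supporting
  hyperplane of \<open>S\<close> at \<open>p\<close> also supports that ball, hence is tangent to it, so the centre
  lies on the inner normal through \<open>p\<close>.
\<close>
lemma convex_inscribed_tangent_ball:
  fixes S :: "'a::euclidean_space set"
  assumes "convex S" and "open S" and "S \<noteq> {}" and "S \<noteq> UNIV"
  obtains p u r where "r > 0" and "norm u = 1" and "ball (p + r *\<^sub>R u) r \<subseteq> S"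
    and "\<And>z. z \<in> S \<Longrightarrow> inner u (z - p) \<ge> 0"
proof -
  obtain c where c: "c \<in> S" using assms by auto
  have ne: "frontier S \<noteq> {}" using assms by (simp add: frontier_eq_empty)
  define r where "r = infdist c (frontier S)"
  obtain p where p: "p \<in> frontier S" "r = dist c p"
    using infdist_attains_inf[OF frontier_closed ne] r_def by metis
  have pS: "p \<notin> S" using p(1) assms(2) by (simp add: frontier_def interior_open)
  then have r: "r > 0" using p(2) c by auto
  have sub: "ball c r \<subseteq> S"
  proof (rule ccontr)
    assume "\<not> ball c r \<subseteq> S"
    moreover have "c \<in> ball c r \<inter> S" using c r by simp
    ultimately have "ball c r \<inter> frontier S \<noteq> {}"
      by (intro connected_Int_frontier[OF connected_ball]) blast+
    then obtain x where "x \<in> ball c r" "x \<in> frontier S" by blast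
    then show False using infdist_le[of x "frontier S" c] r_def by auto
  qed
  obtain u where u: "norm u = 1" "\<And>z. z \<in> S \<Longrightarrow> inner u (z - p) \<ge> 0"
    by (rule convex_supporting_unit_normal[OF assms(1,3) pS]) metis
  have uu: "inner u u = 1" using u(1) by (simp add: norm_eq_1)
  have "inner u (c - p) \<ge> t" if "0 < t" "t < r" for t
  proof -
    have "c - t *\<^sub>R u \<in> S" using sub that u(1) by (auto simp: dist_norm subset_iff)
    from u(2)[OF this] show ?thesis by (simp add: inner_diff_right uu)
  qed
  then have ge: "inner u (c - p) \<ge> r"
    using r by (intro dense_le_bounded[of 0 r]) auto
  have expand: "(norm (x - r *\<^sub>R u))\<^sup>2 = (norm x)\<^sup>2 - 2 * r * inner u x + r\<^sup>2" for x
    unfolding power2_norm_eq_inner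
    by (simp add: inner_diff_left inner_diff_right inner_commute[of x u] uu power2_eq_square
        right_diff_distrib)
  \<comment> \<open>equality case of the Cauchy-Schwarz inequality for \<open>u\<close> and \<open>c - p\<close>\<close>
  have "r * inner u (c - p) \<ge> r * r"
    using ge r by simp
  then have "(norm (c - p - r *\<^sub>R u))\<^sup>2 \<le> 0"
    unfolding expand using p(2) by (simp add: dist_norm power2_eq_square)
  then have "c - p - r *\<^sub>R u = 0"
    by simp
  then have "p + r *\<^sub>R u = c"
    by (simp add: diff_diff_eq)
  then have "ball (p + r *\<^sub>R u) r \<subseteq> S"
    using sub by (simp only:)
  then show ?thesis
    using u by (intro that[OF r])
qed

lemma infdist_frontier_le_outside_point:
  fixes S :: "'a::euclidean_space set"
  assumes "x \<in> closure S" and "y \<notin> S"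
  shows "infdist x (frontier S) \<le> dist x y"
proof (cases "x \<in> S")
  case True
  then obtain z where "z \<in> closed_segment x y" "z \<in> frontier S"
    using connected_Int_frontier[of "closed_segment x y" S] assms(2) by auto
  then show ?thesis
    using infdist_le2[of z "frontier S" x] dist_in_closed_segment[of z x y]
    by (auto simp: dist_commute)
next
  case False
  then have "x \<in> frontier S"
    using assms(1) interior_subset by (auto simp: frontier_def)
  then show ?thesis by simp
qed

text \<open>
  The disc of radius \<open>r\<close> tangent to the imaginary axis at 0 from the right consists of the \<open>z\<close> with
  \<open>norm z ^ 2 < 2 * r * Re z\<close>. Under a dilation by \<open>\<delta>\<close> the left side scales with \<open>\<delta> ^ 2\<close> and
  the right side only with \<open>\<delta>\<close>, so a bounded set at positive distance from the axis enters
  the disc. The rotation \<open>u\<close> and the translation \<open>p\<close> put the disc where it is wanted.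
\<close>
lemma small_dilation_in_tangent_disc:
  fixes w u p :: complex
  assumes "norm u = 1" and "norm w \<le> M" and "Re w \<ge> \<epsilon>" and "\<delta> > 0" and "\<delta> * M\<^sup>2 < 2 * r * \<epsilon>"
    and "r > 0"
  shows "p + u * of_real \<delta> * w \<in> ball (p + r *\<^sub>R u) r"
proof -
  have "\<delta> * (norm w)\<^sup>2 < 2 * r * Re w"
  proof -
    have "\<delta> * (norm w)\<^sup>2 \<le> \<delta> * M\<^sup>2"
      using assms(2,4) by (intro mult_left_mono power_mono) auto
    also have "\<dots> < 2 * r * \<epsilon>" by fact
    also have "\<dots> \<le> 2 * r * Re w" using assms by simp
    finally show ?thesis .
  qed
  then have "\<delta> * (\<delta> * (norm w)\<^sup>2) < \<delta> * (2 * r * Re w)"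
    using assms(4) by simp
  moreover have "(norm (of_real r - of_real \<delta> * w))\<^sup>2 = r\<^sup>2 - \<delta> * (2 * r * Re w) + \<delta> * (\<delta> * (norm w)\<^sup>2)"
    unfolding cmod_power2 by (simp add: power2_eq_square algebra_simps)
  ultimately have "(norm (of_real r - of_real \<delta> * w))\<^sup>2 < r\<^sup>2"
    by linarith
  then have "norm (of_real r - of_real \<delta> * w) < r"
    using assms(6) by (metis power2_less_imp_less less_imp_le)
  moreover have "p + r *\<^sub>R u - (p + u * of_real \<delta> * w) = u * (of_real r - of_real \<delta> * w)"
    by (simp add: scaleR_conv_of_real algebra_simps)
  ultimately show ?thesis
    using assms(1) by (simp only: mem_ball dist_norm norm_mult mult_1)
qed

section \<open>Transfer of the Bohr inequality between convex domains\<close>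

definition bohr_admissible :: "complex set \<Rightarrow> real \<Rightarrow> bool" where
  "bohr_admissible G \<sigma> \<longleftrightarrow> 0 \<le> \<sigma> \<and>
     (\<forall>f a. f \<in> Hinfty right_half_plane \<longrightarrow> f ` right_half_plane \<subseteq> G \<longrightarrow>
        dirichlet_represents a f right_half_plane \<longrightarrow> bohr_inequality G a \<sigma>)"

lemma isometric_bohr_abscissa_altdef:
  "isometric_bohr_abscissa G = (INF \<sigma>\<in>Collect (bohr_admissible G). ereal \<sigma>)"
  unfolding isometric_bohr_abscissa_def bohr_admissible_def by simp

text \<open>
  The rescaled copy \<open>g\<close> of \<open>f\<close> lives in \<open>G2\<close>. Its majorant sum is \<open>\<delta>\<close> times that of \<open>f\<close>, and
  the supporting line of \<open>G2\<close> at the point of tangency keeps its first coefficient within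
  \<open>\<delta> * (d + 2 * \<epsilon>)\<close> of the frontier of \<open>G2\<close>.
\<close>
lemma bohr_sum_le_of_admissible:
  assumes G1: "convex G1" "open G1" "G1 \<noteq> {}" "G1 \<noteq> UNIV"
    and G2: "convex G2" "open G2" "G2 \<noteq> {}" "G2 \<noteq> UNIV"
    and adm: "bohr_admissible G2 \<sigma>"
    and f: "f \<in> Hinfty right_half_plane" "f ` right_half_plane \<subseteq> G1"
    and a: "dirichlet_represents a f right_half_plane"
  shows "summable (\<lambda>n. norm (a (n + 2)) / real (n + 2) powr \<sigma>)" (is ?summable)
    and "(\<Sum>n. norm (a (n + 2)) / real (n + 2) powr \<sigma>) \<le> infdist (a 1) (frontier G1)" (is ?le)
proof -
  define d where "d = infdist (a 1) (frontier G1)"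
  define T where "T = (\<lambda>n. norm (a (n + 2)) / real (n + 2) powr \<sigma>)"
  have "frontier G1 \<noteq> {}" using G1 by (simp add: frontier_eq_empty)
  then obtain q where q: "q \<in> frontier G1" "d = dist (a 1) q"
    using infdist_attains_inf[OF frontier_closed] d_def by metis
  then have "q \<notin> G1" using G1 by (simp add: frontier_def interior_open)
  then obtain v where v: "norm v = 1" "\<And>z. z \<in> G1 \<Longrightarrow> inner v (z - q) \<ge> 0"
    by (rule convex_supporting_unit_normal[OF G1(1,3)]) metis
  obtain p u r where r: "r > 0" and u: "norm u = 1" and disc: "ball (p + r *\<^sub>R u) r \<subseteq> G2"
    and supp: "\<And>z. z \<in> G2 \<Longrightarrow> inner u (z - p) \<ge> 0"
    by (rule convex_inscribed_tangent_ball[OF G2]) metis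
  have bdd: "bounded (f ` right_half_plane)" and hol: "f holomorphic_on right_half_plane"
    using f(1) by (auto simp: Hinfty_def)
  obtain B where B: "\<And>s. s \<in> right_half_plane \<Longrightarrow> norm (f s) \<le> B"
    using bdd by (auto simp: bounded_iff)
  have main: "summable T \<and> suminf T < d + 2 * \<epsilon>" if "\<epsilon> > 0" for \<epsilon>
  proof -
    define M where "M = \<bar>B\<bar> + norm q + \<epsilon> + 1"
    have M: "M > 0" unfolding M_def using that by (simp add: add_nonneg_pos)
    define \<delta> where "\<delta> = r * \<epsilon> / M\<^sup>2"
    have \<delta>: "\<delta> > 0" "\<delta> * M\<^sup>2 < 2 * r * \<epsilon>"
      using r that M by (auto simp: \<delta>_def)
    \<comment> \<open>takes the supporting half-plane of \<open>G1\<close> at \<open>q\<close> to \<open>Re z \<ge> \<epsilon>\<close>\<close>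
    define w where "w = (\<lambda>z. cnj v * (z - q) + of_real \<epsilon>)"
    define k where "k = u * of_real \<delta> * cnj v"
    define c where "c = p + u * of_real \<delta> * (of_real \<epsilon> - cnj v * q)"
    have image: "c + k * z = p + u * of_real \<delta> * w z" for z
      by (simp add: c_def k_def w_def algebra_simps)
    have Re_w: "Re (w z) = inner v (z - q) + \<epsilon>" for z
      by (simp add: w_def inner_complex_def algebra_simps)
    define g where "g = (\<lambda>s. c + k * f s)"
    define b where "b = (\<lambda>n. (if n = 1 then c else 0) + k * a n)"
    have gG2: "g ` right_half_plane \<subseteq> G2"
    proof (rule image_subsetI)
      fix s assume s: "s \<in> right_half_plane"
      have "norm (w (f s)) \<le> norm (f s - q) + \<epsilon>"
        unfolding w_def using v(1) that norm_triangle_ineq[of "cnj v * (f s - q)" "of_real \<epsilon>"]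
        by (simp add: norm_mult)
      also have "\<dots> \<le> M"
        using norm_triangle_ineq4[of "f s" q] B[OF s] by (simp add: M_def)
      finally have "norm (w (f s)) \<le> M" .
      moreover have "Re (w (f s)) \<ge> \<epsilon>" using Re_w v(2) f(2) s by auto
      ultimately have "p + u * of_real \<delta> * w (f s) \<in> ball (p + r *\<^sub>R u) r"
        using small_dilation_in_tangent_disc[OF u _ _ \<delta> r] by blast
      then show "g s \<in> G2" using disc by (auto simp: g_def image)
    qed
    have "g holomorphic_on right_half_plane"
      unfolding g_def by (intro holomorphic_intros hol)
    moreover have "bounded (g ` right_half_plane)"
    proof -
      have "g ` right_half_plane = (\<lambda>z. c + z) ` (\<lambda>z. k * z) ` f ` right_half_plane"
        by (simp add: g_def image_image)
      then show ?thesis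
        using bdd by (simp add: bounded_translation bounded_linear_image bounded_linear_mult_right)
    qed
    ultimately have g: "g \<in> Hinfty right_half_plane" by (simp add: Hinfty_def)
    have b: "dirichlet_represents b g right_half_plane"
      unfolding b_def g_def by (rule dirichlet_represents_affine[OF a])
    have "bohr_inequality G2 b \<sigma>"
      using adm g gG2 b by (auto simp: bohr_admissible_def)
    moreover have "norm (b (n + 2)) / real (n + 2) powr \<sigma> = \<delta> * T n" for n
      using u v(1) \<delta>(1) by (simp add: b_def k_def T_def norm_mult)
    ultimately have sum: "summable (\<lambda>n. \<delta> * T n)"
      and less: "(\<Sum>n. \<delta> * T n) < infdist (b 1) (frontier G2)"
      using G2(1) unfolding bohr_inequality_def by (simp_all add: hull_same)
    have T: "summable T"
      using summable_mult[OF sum, of "1 / \<delta>"] \<delta>(1) by simp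
    have b1: "b 1 = p + u * of_real \<delta> * w (a 1)" by (simp add: b_def image)
    \<comment> \<open>the foot of the perpendicular from \<open>b 1\<close> to the supporting line of \<open>G2\<close>, pushed by
      \<open>\<delta> * \<epsilon>\<close> beyond that line, where no point of \<open>G2\<close> is left\<close>
    define y where "y = b 1 - u * of_real (\<delta> * (Re (w (a 1)) + \<epsilon>))"
    have unorm: "u * cnj u = 1" using u by (simp add: complex_norm_square[symmetric])
    have "inner u (y - p) = Re (cnj u * (y - p))" by (simp add: inner_complex_def)
    also have "cnj u * (y - p) = (u * cnj u) * (of_real \<delta> * (w (a 1) - Re (w (a 1)) - \<epsilon>))"
      unfolding y_def b1 by (simp add: algebra_simps)
    also have "Re \<dots> < 0" using \<delta>(1) that by (simp add: unorm)
    finally have "y \<notin> G2" using supp by fastforce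
    have "\<delta> * suminf T < infdist (b 1) (frontier G2)"
      using less by (simp add: suminf_mult[OF T])
    also have "\<dots> \<le> dist (b 1) y"
      by (rule infdist_frontier_le_outside_point[OF dirichlet_first_coefficient_in_closure[OF b gG2] \<open>y \<notin> G2\<close>])
    also have "\<dots> = \<delta> * \<bar>Re (w (a 1)) + \<epsilon>\<bar>"
      using u \<delta>(1) by (simp add: y_def dist_norm norm_mult abs_mult del: of_real_add of_real_mult)
    also have "\<dots> \<le> \<delta> * (d + 2 * \<epsilon>)"
    proof -
      have "\<bar>inner v (a 1 - q)\<bar> \<le> d"
        using Cauchy_Schwarz_ineq2[of v "a 1 - q"] v(1) q(2) by (simp add: dist_norm)
      then show ?thesis using \<delta>(1) that by (simp add: Re_w)
    qed
    finally show ?thesis using T \<delta>(1) by simp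
  qed
  show ?summable using main[of 1] by (simp add: T_def)
  have "suminf T \<le> d + \<epsilon>" if "\<epsilon> > 0" for \<epsilon>
    using main[of "\<epsilon> / 2"] that by simp
  then show ?le unfolding T_def[symmetric] d_def[symmetric] by (rule field_le_epsilon)
qed

text \<open>
  The gain \<open>2 powr (\<sigma> - \<tau>)\<close> makes the bound of the previous lemma strict as soon as the distance
  \<open>d\<close> is positive. It is: with \<open>d = 0\<close> that bound kills all coefficients of index at least 2, so
  \<open>f\<close> is the constant \<open>a 1\<close>, a value in the open set \<open>G1\<close>.
\<close>
lemma bohr_admissible_transfer:
  assumes G1: "convex G1" "open G1" "G1 \<noteq> {}" "G1 \<noteq> UNIV"
    and G2: "convex G2" "open G2" "G2 \<noteq> {}" "G2 \<noteq> UNIV"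
    and adm: "bohr_admissible G2 \<sigma>" and "\<sigma> < \<tau>"
  shows "bohr_admissible G1 \<tau>"
  unfolding bohr_admissible_def
proof (intro conjI allI impI)
  show "0 \<le> \<tau>" using adm \<open>\<sigma> < \<tau>\<close> by (simp add: bohr_admissible_def)
  fix f a
  assume f: "f \<in> Hinfty right_half_plane" "f ` right_half_plane \<subseteq> G1"
    and a: "dirichlet_represents a f right_half_plane"
  define d where "d = infdist (a 1) (frontier G1)"
  define T where "T = (\<lambda>\<sigma> n. norm (a (n + 2)) / real (n + 2) powr \<sigma>)"
  have T: "summable (T \<sigma>)" "suminf (T \<sigma>) \<le> d"
    using bohr_sum_le_of_admissible[OF G1 G2 adm f a] by (simp_all add: T_def d_def)
  have T0: "T \<rho> n \<ge> 0" for \<rho> n by (simp add: T_def)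
  have "d > 0"
  proof (rule ccontr)
    assume "\<not> d > 0"
    then have d0: "d = 0" using infdist_nonneg[of "a 1" "frontier G1"] by (simp add: d_def)
    then have "suminf (T \<sigma>) = 0" using T T0 suminf_nonneg[OF T(1)] by force
    then have "T \<sigma> n = 0" for n using suminf_eq_zero_iff[OF T(1)] T0 by simp
    then have zero: "a (n + 2) = 0" for n by (simp add: T_def)
    have "(\<lambda>n. a (Suc n) * of_nat (Suc n) powr (- 1)) sums f 1"
      using a by (auto simp: dirichlet_represents_def right_half_plane_def)
    moreover have "(\<lambda>n. a (Suc n) * of_nat (Suc n) powr (- 1)) = (\<lambda>n. if n = 0 then a 1 else 0)"
    proof
      fix n show "a (Suc n) * of_nat (Suc n) powr (- 1) = (if n = 0 then a 1 else 0)"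
        using zero[of "n - 1"] by (cases n) auto
    qed
    ultimately have "f 1 = a 1"
      using sums_single[of 0 "\<lambda>_. a 1"] sums_unique2 by metis
    moreover have "1 \<in> right_half_plane" by (simp add: right_half_plane_def)
    ultimately have "a 1 \<in> G1" using f(2) by (metis image_subset_iff)
    moreover have "a 1 \<in> frontier G1"
      using d0 G1 in_closed_iff_infdist_zero[OF frontier_closed[of G1]]
      by (simp add: d_def frontier_eq_empty)
    ultimately show False using G1(2) by (simp add: frontier_def interior_open)
  qed
  have le: "T \<tau> n \<le> 2 powr (\<sigma> - \<tau>) * T \<sigma> n" for n
  proof -
    have "real (n + 2) powr (\<sigma> - \<tau>) \<le> 2 powr (\<sigma> - \<tau>)"
      using \<open>\<sigma> < \<tau>\<close> by (intro powr_mono2') auto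
    moreover have "T \<tau> n = real (n + 2) powr (\<sigma> - \<tau>) * T \<sigma> n"
      by (simp add: T_def powr_diff)
    ultimately show ?thesis using T0 by (simp add: mult_right_mono)
  qed
  have sT: "summable (T \<tau>)"
    by (rule summable_comparison_test'[OF summable_mult[OF T(1)]]) (use le T0 in auto)
  have "suminf (T \<tau>) \<le> 2 powr (\<sigma> - \<tau>) * suminf (T \<sigma>)"
    using suminf_le[OF le sT summable_mult[OF T(1)]] by (simp add: suminf_mult[OF T(1)])
  also have "\<dots> \<le> 2 powr (\<sigma> - \<tau>) * d"
    using T(2) by (intro mult_left_mono) auto
  also have "\<dots> < 1 * d"
    using \<open>d > 0\<close> \<open>\<sigma> < \<tau>\<close> by (intro mult_strict_right_mono) (auto simp: powr_less_one)
  finally show "bohr_inequality G1 a \<tau>"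
    using sT G1(1) by (simp add: bohr_inequality_def T_def d_def hull_same)
qed

lemma isometric_bohr_abscissa_le:
  assumes "convex G1" "open G1" "G1 \<noteq> {}" "G1 \<noteq> UNIV"
    and "convex G2" "open G2" "G2 \<noteq> {}" "G2 \<noteq> UNIV"
  shows "isometric_bohr_abscissa G1 \<le> isometric_bohr_abscissa G2"
  unfolding isometric_bohr_abscissa_altdef[of G2]
proof (rule INF_greatest)
  fix \<sigma> assume "\<sigma> \<in> Collect (bohr_admissible G2)"
  then have "bohr_admissible G1 (\<sigma> + e)" if "e > 0" for e
    using bohr_admissible_transfer[OF assms] that by simp
  then have "isometric_bohr_abscissa G1 \<le> ereal \<sigma> + ereal e" if "e > 0" for e
    using that unfolding isometric_bohr_abscissa_altdef by (intro INF_lower2[of "\<sigma> + e"]) auto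
  then show "isometric_bohr_abscissa G1 \<le> ereal \<sigma>"
    by (simp add: ereal_le_epsilon2)
qed

theorem corollary2p1:
  fixes G1 G2 :: "complex set"
  assumes "planar_domain G1" and "bounded G1" and "convex G1"
    and "planar_domain G2" and "bounded G2" and "convex G2"
  shows "isometric_bohr_abscissa G1 = isometric_bohr_abscissa G2"
proof -
  have "G1 \<noteq> UNIV" "G2 \<noteq> UNIV"
    using assms not_bounded_UNIV[where 'a = complex] by auto
  then show ?thesis
    using assms unfolding planar_domain_def by (metis antisym isometric_bohr_abscissa_le)
qed

end
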